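(* Let $R$ be a $\mathbb Z$-graded graded-commutative ring, $M$ a graded $R$-module and $\mathfrak a$ a (homogeneous) ideal of $R$. Then: (a) If $M$ is $\mathfrak a$-torsion then $\mathrm{supp}_R M\subseteq\mathcal V(\mathfrak a)$. (b) $\mathrm{supp}_R M\subseteq\mathcal V(\mathfrak a)$ if and only if $M$ is $\mathfrak b$-torsion for any finitely generated ideal $\mathfrak b\subseteq\mathfrak a$.
   Context: All ideals and modules are graded, i.e. ideals are homogeneous. $\mathrm{Spec}^h(R)$ is the set of homogeneous prime ideals of $R$, and $\mathcal V(\mathfrak a)=\{\mathfrak p\in\mathrm{Spec}^h(R):\mathfrak p\supseteq\mathfrak a\}$. The (small) support $\mathrm{supp}_RM$ is defined as the set of weakly associated primes of $M$: those $\mathfrak p\in\mathrm{Spec}^h(R)$ for which there is a homogeneous $m\in M$ such that $\mathfrak p$ is minimal among the homogeneous primes containing $\mathrm{Ann}(m)$. $M$ is $\mathfrak a$-torsion if every element of $M$ is annihilated by a power of $\mathfrak a$. No Noetherian assumption is made. *)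

theory Defs
  imports "HOL-Algebra.Algebra"
begin

section \<open>Gradings by the integers\<close>

definition homogeneous_decomp ::
    "('a, 'm) ring_scheme \<Rightarrow> (int \<Rightarrow> 'a set) \<Rightarrow> 'a \<Rightarrow> (int \<Rightarrow> 'a) \<Rightarrow> bool" where
  "homogeneous_decomp G A x f \<longleftrightarrow>
     (\<forall>n. f n \<in> A n) \<and> finite {n. f n \<noteq> \<zero>\<^bsub>G\<^esub>} \<and>
     x = (\<Oplus>\<^bsub>G\<^esub>n\<in>{n. f n \<noteq> \<zero>\<^bsub>G\<^esub>}. f n)"

text \<open>The additive group \<open>G\<close> is the internal direct sum of the subgroups \<open>A n\<close>.\<close>

locale grading = abelian_group G for G (structure) +
  fixes A :: "int \<Rightarrow> 'a set"
  assumes component_subgroup: "additive_subgroup (A n) G"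
    and unique_decomp: "x \<in> carrier G \<Longrightarrow> \<exists>!f. homogeneous_decomp G A x f"

locale graded_ring = ring R + grading R A for R (structure) and A +
  assumes one_degree: "\<one> \<in> A 0"
    and mult_degree: "\<lbrakk>x \<in> A i; y \<in> A j\<rbrakk> \<Longrightarrow> x \<otimes> y \<in> A (i + j)"

text \<open>The Koszul sign rule \<open>x y = (-1)^(i j) y x\<close>.  Squares of elements of odd degree are
  not required to vanish.\<close>

locale graded_commutative_ring = graded_ring +
  assumes graded_commute: "\<lbrakk>x \<in> A i; y \<in> A j\<rbrakk> \<Longrightarrow>
    x \<otimes> y = (if even (i * j) then y \<otimes> x else \<ominus> (y \<otimes> x))"

text \<open>The axioms are those of \<^locale>\<open>module\<close>, but over a ring that need not be commutative.\<close>

locale left_module = R?: ring R + M?: abelian_group M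
    for R :: "('a, 'm) ring_scheme" (structure) and M :: "('a, 'b, 'n) module_scheme" (structure) +
  assumes smult_closed:
      "\<lbrakk>r \<in> carrier R; x \<in> carrier M\<rbrakk> \<Longrightarrow> r \<odot>\<^bsub>M\<^esub> x \<in> carrier M"
    and smult_l_distr:
      "\<lbrakk>r \<in> carrier R; s \<in> carrier R; x \<in> carrier M\<rbrakk> \<Longrightarrow>
       (r \<oplus>\<^bsub>R\<^esub> s) \<odot>\<^bsub>M\<^esub> x = r \<odot>\<^bsub>M\<^esub> x \<oplus>\<^bsub>M\<^esub> s \<odot>\<^bsub>M\<^esub> x"
    and smult_r_distr:
      "\<lbrakk>r \<in> carrier R; x \<in> carrier M; y \<in> carrier M\<rbrakk> \<Longrightarrow>
       r \<odot>\<^bsub>M\<^esub> (x \<oplus>\<^bsub>M\<^esub> y) = r \<odot>\<^bsub>M\<^esub> x \<oplus>\<^bsub>M\<^esub> r \<odot>\<^bsub>M\<^esub> y"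
    and smult_assoc:
      "\<lbrakk>r \<in> carrier R; s \<in> carrier R; x \<in> carrier M\<rbrakk> \<Longrightarrow>
       (r \<otimes>\<^bsub>R\<^esub> s) \<odot>\<^bsub>M\<^esub> x = r \<odot>\<^bsub>M\<^esub> (s \<odot>\<^bsub>M\<^esub> x)"
    and smult_one: "x \<in> carrier M \<Longrightarrow> \<one>\<^bsub>R\<^esub> \<odot>\<^bsub>M\<^esub> x = x"

locale graded_module =
    left_module R M + R?: graded_ring R A + M?: grading M B
    for R :: "('a, 'm) ring_scheme" (structure) and A
      and M :: "('a, 'b, 'n) module_scheme" (structure) and B +
  assumes smult_degree: "\<lbrakk>r \<in> A i; x \<in> B j\<rbrakk> \<Longrightarrow> r \<odot>\<^bsub>M\<^esub> x \<in> B (i + j)"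


section \<open>Homogeneous ideals and primes\<close>

text \<open>Ideals are two-sided.  In a graded-commutative ring every homogeneous one-sided ideal is
  two-sided, so this is no restriction.\<close>

definition homogeneous_ideal ::
    "('a, 'm) ring_scheme \<Rightarrow> (int \<Rightarrow> 'a set) \<Rightarrow> 'a set \<Rightarrow> bool" where
  "homogeneous_ideal R A I \<longleftrightarrow>
     ideal I R \<and> (\<forall>x\<in>I. \<forall>f. homogeneous_decomp R A x f \<longrightarrow> (\<forall>n. f n \<in> I))"

definition finitely_generated_ideal :: "('a, 'm) ring_scheme \<Rightarrow> 'a set \<Rightarrow> bool" where
  "finitely_generated_ideal R I \<longleftrightarrow> (\<exists>S. finite S \<and> S \<subseteq> carrier R \<and> I = Idl\<^bsub>R\<^esub> S)"

text \<open>The condition on products is that of \<^locale>\<open>primeideal\<close>, which is not available here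
  because it demands a commutative ring.  It is enough to test it on homogeneous elements, see
  \<open>Spec_h_iff\<close> below.\<close>

definition Spec_h :: "('a, 'm) ring_scheme \<Rightarrow> (int \<Rightarrow> 'a set) \<Rightarrow> 'a set set" where
  "Spec_h R A = {p. homogeneous_ideal R A p \<and> carrier R \<noteq> p \<and>
     (\<forall>x\<in>carrier R. \<forall>y\<in>carrier R. x \<otimes>\<^bsub>R\<^esub> y \<in> p \<longrightarrow> x \<in> p \<or> y \<in> p)}"

definition V_h :: "('a, 'm) ring_scheme \<Rightarrow> (int \<Rightarrow> 'a set) \<Rightarrow> 'a set \<Rightarrow> 'a set set" where
  "V_h R A I = {p \<in> Spec_h R A. I \<subseteq> p}"


section \<open>Support and torsion\<close>

definition Ann :: "('a, 'm) ring_scheme \<Rightarrow> ('a, 'b, 'n) module_scheme \<Rightarrow> 'b \<Rightarrow> 'a set" where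
  "Ann R M x = {r \<in> carrier R. r \<odot>\<^bsub>M\<^esub> x = \<zero>\<^bsub>M\<^esub>}"

definition small_supp :: "('a, 'm) ring_scheme \<Rightarrow> (int \<Rightarrow> 'a set) \<Rightarrow>
    ('a, 'b, 'n) module_scheme \<Rightarrow> (int \<Rightarrow> 'b set) \<Rightarrow> 'a set set" where
  "small_supp R A M B = {p \<in> Spec_h R A. \<exists>x\<in>(\<Union>n. B n).
     Ann R M x \<subseteq> p \<and> (\<forall>q\<in>Spec_h R A. Ann R M x \<subseteq> q \<and> q \<subseteq> p \<longrightarrow> q = p)}"

text \<open>Powers are taken in the multiplicative monoid \<^const>\<open>ideals_set\<close> of ideals, whose product is
  \<^const>\<open>ideal_prod\<close> and whose unit is the whole ring.\<close>

definition torsion_module ::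
    "('a, 'm) ring_scheme \<Rightarrow> ('a, 'b, 'n) module_scheme \<Rightarrow> 'a set \<Rightarrow> bool" where
  "torsion_module R M I \<longleftrightarrow>
     (\<forall>x\<in>carrier M. \<exists>n::nat. \<forall>r \<in> I [^]\<^bsub>ideals_set R\<^esub> n. r \<odot>\<^bsub>M\<^esub> x = \<zero>\<^bsub>M\<^esub>)"


section \<open>Primality can be tested on homogeneous elements\<close>

context grading
begin

lemma component_carrier: "x \<in> A n \<Longrightarrow> x \<in> carrier G"
  using component_subgroup additive_subgroup.a_subset by blast

lemma component_zero: "\<zero> \<in> A n"
  by (rule additive_subgroup.zero_closed[OF component_subgroup])

lemma component_add: "\<lbrakk>x \<in> A n; y \<in> A n\<rbrakk> \<Longrightarrow> x \<oplus> y \<in> A n"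
  by (rule additive_subgroup.a_closed[OF component_subgroup])

lemma decompI:
  assumes "\<And>n. f n \<in> A n" "finite S" "\<And>n. n \<notin> S \<Longrightarrow> f n = \<zero>" "x = (\<Oplus>n\<in>S. f n)"
  shows "homogeneous_decomp G A x f"
proof -
  have sub: "{n. f n \<noteq> \<zero>} \<subseteq> S" using assms(3) by blast
  have "(\<Oplus>n\<in>{n. f n \<noteq> \<zero>}. f n) = (\<Oplus>n\<in>S. f n)"
    by (rule add.finprod_mono_neutral_cong_left[OF assms(2) sub])
      (use assms(1) component_carrier in auto)
  then show ?thesis
    using assms(1,4) finite_subset[OF sub assms(2)] by (simp add: homogeneous_decomp_def)
qed

lemma decompD:
  assumes "homogeneous_decomp G A x f" "finite S" "{n. f n \<noteq> \<zero>} \<subseteq> S"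
  shows "x = (\<Oplus>n\<in>S. f n)"
proof -
  have "(\<Oplus>n\<in>{n. f n \<noteq> \<zero>}. f n) = (\<Oplus>n\<in>S. f n)"
    by (rule add.finprod_mono_neutral_cong_left[OF assms(2,3)])
      (use assms(1) component_carrier in \<open>auto simp: homogeneous_decomp_def\<close>)
  then show ?thesis using assms(1) by (simp add: homogeneous_decomp_def)
qed

lemma decomp_zero: "homogeneous_decomp G A \<zero> (\<lambda>n. \<zero>)"
  by (rule decompI[of _ "{}"]) (auto simp: component_zero)

lemma decomp_add:
  assumes f: "homogeneous_decomp G A x f" and g: "homogeneous_decomp G A y g"
  shows "homogeneous_decomp G A (x \<oplus> y) (\<lambda>n. f n \<oplus> g n)"
proof -
  define S where "S = {n. f n \<noteq> \<zero>} \<union> {n. g n \<noteq> \<zero>}"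
  have fA: "f n \<in> A n" and gA: "g n \<in> A n" for n
    using f g by (auto simp: homogeneous_decomp_def)
  have fin: "finite S" using f g by (auto simp: S_def homogeneous_decomp_def)
  show ?thesis
  proof (rule decompI[OF _ fin])
    show "x \<oplus> y = (\<Oplus>n\<in>S. f n \<oplus> g n)"
    proof -
      have "(\<Oplus>n\<in>S. f n \<oplus> g n) = (\<Oplus>n\<in>S. f n) \<oplus> (\<Oplus>n\<in>S. g n)"
        by (rule finsum_addf) (use fA gA component_carrier in blast)+
      moreover have "x = (\<Oplus>n\<in>S. f n)" "y = (\<Oplus>n\<in>S. g n)"
        by (rule decompD[OF f fin], simp add: S_def) (rule decompD[OF g fin], simp add: S_def)
      ultimately show ?thesis by simp
    qed
  qed (auto simp: S_def component_add fA gA)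
qed

end

context graded_ring
begin

lemma decomp_mult_right:
  assumes f: "homogeneous_decomp R A x f" and y: "y \<in> A j"
  shows "homogeneous_decomp R A (x \<otimes> y) (\<lambda>n. f (n - j) \<otimes> y)"
proof -
  define S where "S = {n. f n \<noteq> \<zero>}"
  have fA: "f n \<in> A n" for n using f by (auto simp: homogeneous_decomp_def)
  have fin: "finite S" using f by (auto simp: S_def homogeneous_decomp_def)
  have yc: "y \<in> carrier R" using y by (rule component_carrier)
  note fc = fA[THEN component_carrier]
  show ?thesis
  proof (rule decompI[where S = "(\<lambda>n. n + j) ` S"])
    show "f (n - j) \<otimes> y \<in> A n" for n using mult_degree[OF fA y, of "n - j"] by simp
    show "f (n - j) \<otimes> y = \<zero>" if "n \<notin> (\<lambda>n. n + j) ` S" for n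
    proof -
      have "n - j \<notin> S" using that by (metis diff_add_cancel image_eqI)
      then show ?thesis using yc by (simp add: S_def)
    qed
    have "(\<Oplus>n\<in>(\<lambda>n. n + j) ` S. f (n - j) \<otimes> y) = (\<Oplus>n\<in>S. f n \<otimes> y)"
      by (subst finsum_reindex) (auto simp: fc yc inj_on_def)
    also have "\<dots> = (\<Oplus>n\<in>S. f n) \<otimes> y"
      by (rule finsum_ldistr[symmetric]) (auto simp: fin yc fc)
    finally show "x \<otimes> y = (\<Oplus>n\<in>(\<lambda>n. n + j) ` S. f (n - j) \<otimes> y)"
      using decompD[OF f fin] by (simp add: S_def)
  qed (use fin in simp)
qed

lemma decomp_mult:
  assumes f: "homogeneous_decomp R A x f" and xc: "x \<in> carrier R"
    and g: "\<And>n. g n \<in> A n" and "finite T"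
  shows "homogeneous_decomp R A (x \<otimes> (\<Oplus>j\<in>T. g j)) (\<lambda>n. \<Oplus>j\<in>T. f (n - j) \<otimes> g j)"
  using \<open>finite T\<close>
proof (induction T rule: finite_induct)
  case empty
  then show ?case using xc decomp_zero by simp
next
  case (insert k T)
  have fc: "f n \<in> carrier R" and gc: "g n \<in> carrier R" for n
    using f g component_carrier by (auto simp: homogeneous_decomp_def)
  have "(\<Oplus>j\<in>insert k T. g j) = g k \<oplus> (\<Oplus>j\<in>T. g j)"
    by (rule finsum_insert) (use insert gc in auto)
  moreover have "(\<Oplus>j\<in>T. g j) \<in> carrier R" using gc by (auto intro: finsum_closed)
  ultimately have 1: "x \<otimes> (\<Oplus>j\<in>insert k T. g j) = x \<otimes> g k \<oplus> x \<otimes> (\<Oplus>j\<in>T. g j)"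
    by (simp add: r_distr xc gc)
  have 2: "(\<Oplus>j\<in>insert k T. f (n - j) \<otimes> g j)
      = f (n - k) \<otimes> g k \<oplus> (\<Oplus>j\<in>T. f (n - j) \<otimes> g j)" for n
    by (rule finsum_insert) (use insert gc fc in auto)
  show ?case unfolding 1 2
    by (rule decomp_add[OF decomp_mult_right[OF f g] insert.IH])
qed

lemma finsum_in_ideal:
  assumes "ideal I R" "finite S" "\<And>n. n \<in> S \<Longrightarrow> f n \<in> I"
  shows "(\<Oplus>n\<in>S. f n) \<in> I"
  using assms(2,3)
proof (induction S rule: finite_induct)
  case empty
  then show ?case using assms(1) by (simp add: additive_subgroup.zero_closed ideal.axioms(1))
next
  case (insert k S)
  have "f ` insert k S \<subseteq> carrier R"
    using insert.prems ideal.Icarr[OF assms(1)] by blast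
  then have "(\<Oplus>n\<in>insert k S. f n) = f k \<oplus> (\<Oplus>n\<in>S. f n)"
    by (intro finsum_insert) (use insert in auto)
  then show ?case
    using insert assms(1) by (simp add: additive_subgroup.a_closed ideal.axioms(1))
qed

lemma top_component_notin:
  assumes I: "ideal I R" and f: "homogeneous_decomp R A x f" and "x \<notin> I"
  obtains i where "f i \<notin> I" "\<And>n. i < n \<Longrightarrow> f n \<in> I"
proof -
  define S where "S = {n. f n \<notin> I}"
  have "S \<subseteq> {n. f n \<noteq> \<zero>}"
    using I by (auto simp: S_def additive_subgroup.zero_closed ideal.axioms(1))
  then have "finite S" using f finite_subset by (auto simp: homogeneous_decomp_def)
  moreover have "S \<noteq> {}"
    using finsum_in_ideal[OF I, of "{n. f n \<noteq> \<zero>}" f] f \<open>x \<notin> I\<close>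
    by (auto simp: S_def homogeneous_decomp_def)
  ultimately have "Max S \<in> S" and "\<forall>n. Max S < n \<longrightarrow> n \<notin> S" by (auto dest: Max_ge)
  then have "f (Max S) \<notin> I" "\<And>n. Max S < n \<Longrightarrow> f n \<in> I" unfolding S_def by blast+
  then show ?thesis by (rule that)
qed

theorem Spec_h_iff:
  "p \<in> Spec_h R A \<longleftrightarrow> homogeneous_ideal R A p \<and> carrier R \<noteq> p \<and>
     (\<forall>x\<in>(\<Union>n. A n). \<forall>y\<in>(\<Union>n. A n). x \<otimes> y \<in> p \<longrightarrow> x \<in> p \<or> y \<in> p)"
  (is "_ \<longleftrightarrow> ?h \<and> ?n \<and> ?t")
proof
  assume "p \<in> Spec_h R A"
  then show "?h \<and> ?n \<and> ?t" using component_carrier unfolding Spec_h_def by blast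
next
  assume rhs: "?h \<and> ?n \<and> ?t"
  then have p: "ideal p R" by (simp add: homogeneous_ideal_def)
  have "x \<in> p \<or> y \<in> p" if x: "x \<in> carrier R" and y: "y \<in> carrier R" and xy: "x \<otimes> y \<in> p" for x y
  proof (rule ccontr)
    assume nin: "\<not> (x \<in> p \<or> y \<in> p)"
    obtain f where f: "homogeneous_decomp R A x f" using unique_decomp[OF x] by blast
    obtain g where g: "homogeneous_decomp R A y g" using unique_decomp[OF y] by blast
    obtain i where i: "f i \<notin> p" "\<And>n. i < n \<Longrightarrow> f n \<in> p"
      using top_component_notin[OF p f] nin by blast
    obtain j where j: "g j \<notin> p" "\<And>n. j < n \<Longrightarrow> g n \<in> p"
      using top_component_notin[OF p g] nin by blast
    have fA: "f n \<in> A n" and gA: "g n \<in> A n" for n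
      using f g by (auto simp: homogeneous_decomp_def)
    note c = fA[THEN component_carrier] gA[THEN component_carrier]
    define T where "T = insert j {n. g n \<noteq> \<zero>}"
    have T: "finite T" using g by (simp add: T_def homogeneous_decomp_def)
    have "y = (\<Oplus>n\<in>T. g n)" by (rule decompD[OF g T]) (auto simp: T_def)
    then have "homogeneous_decomp R A (x \<otimes> y) (\<lambda>n. \<Oplus>k\<in>T. f (n - k) \<otimes> g k)"
      using decomp_mult[OF f x gA T] by simp
    then have "(\<Oplus>k\<in>T. f ((i + j) - k) \<otimes> g k) \<in> p"
      using rhs xy unfolding homogeneous_ideal_def by blast
    also have "T = insert j (T - {j})" by (auto simp: T_def)
    also have "(\<Oplus>k\<in>\<dots>. f ((i + j) - k) \<otimes> g k)
        = f i \<otimes> g j \<oplus> (\<Oplus>k\<in>T - {j}. f ((i + j) - k) \<otimes> g k)"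
      by (subst finsum_insert) (use T c in auto)
    finally have fst_in: "f i \<otimes> g j \<oplus> (\<Oplus>k\<in>T - {j}. f ((i + j) - k) \<otimes> g k) \<in> p"
      (is "_ \<oplus> ?t \<in> p") .
    have "(\<Oplus>k\<in>T - {j}. f ((i + j) - k) \<otimes> g k) \<in> p"
    proof (rule finsum_in_ideal[OF p])
      fix k assume "k \<in> T - {j}"
      then consider "j < k" | "i < (i + j) - k" by fastforce
      then show "f ((i + j) - k) \<otimes> g k \<in> p"
        by cases (use i(2) j(2) c ideal.I_l_closed[OF p] ideal.I_r_closed[OF p] in blast)+
    qed (use T in simp)
    then have "(f i \<otimes> g j \<oplus> ?t) \<oplus> \<ominus> ?t \<in> p" and "?t \<in> carrier R"
      by (auto intro!: additive_subgroup.a_closed[OF ideal.axioms(1)[OF p] fst_in]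
          additive_subgroup.a_inv_closed[OF ideal.axioms(1)[OF p]] ideal.Icarr[OF p])
    then have "f i \<otimes> g j \<in> p" using c by (simp add: a_assoc r_neg)
    then show False using rhs i(1) j(1) fA gA by blast
  qed
  then show "p \<in> Spec_h R A" using rhs by (simp add: Spec_h_def)
qed

end

end

theory Submission
  imports Defs
begin

text \<open>
  If a power of \<open>a\<close> kills \<open>m\<close>, then \<open>a\<close> lies in every prime over the annihilator of \<open>m\<close>; this gives (a)
  and one direction of (b). Conversely, suppose that no power of the finitely generated homogeneous
  ideal \<open>J\<close> kills the homogeneous element \<open>m\<close>. All powers of \<open>J\<close> are finitely generated, so Zorn's lemma
  yields a homogeneous ideal \<open>q\<close> maximal among those containing the annihilator of \<open>m\<close> but no power of
  \<open>J\<close>. It is prime, and a minimal prime over the annihilator inside \<open>q\<close> is a point of the support that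
  does not contain \<open>J\<close>.
\<close>

section \<open>Ideals and their powers\<close>

context ring
begin

lemma ideal_if_closed:
  assumes "I \<subseteq> carrier R" "\<zero> \<in> I" "\<And>x y. \<lbrakk>x \<in> I; y \<in> I\<rbrakk> \<Longrightarrow> x \<oplus> y \<in> I"
    and l: "\<And>x r. \<lbrakk>x \<in> I; r \<in> carrier R\<rbrakk> \<Longrightarrow> r \<otimes> x \<in> I"
    and "\<And>x r. \<lbrakk>x \<in> I; r \<in> carrier R\<rbrakk> \<Longrightarrow> x \<otimes> r \<in> I"
  shows "ideal I R"
proof (rule idealI)
  have "\<ominus> x \<in> I" if "x \<in> I" for x
    using l[OF that, of "\<ominus> \<one>"] assms(1) that by (simp add: l_minus subset_iff)
  then show "subgroup I (add_monoid R)"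
    using assms(1-3) by (intro subgroup.intro) (auto simp flip: a_inv_def)
qed (use assms in \<open>auto intro: ring_axioms\<close>)

lemma ideal_prod_genideal_subset:
  assumes K: "ideal K R" and S: "S \<subseteq> carrier R" and T: "T \<subseteq> carrier R"
    and STK: "\<And>s r t. \<lbrakk>s \<in> S; r \<in> carrier R; t \<in> T\<rbrakk> \<Longrightarrow> s \<otimes> r \<otimes> t \<in> K"
  shows "(Idl S) \<cdot> (Idl T) \<subseteq> K"
proof -
  interpret K: ideal K R by fact
  define T' where "T' = {y \<in> carrier R. \<forall>s\<in>S. \<forall>r\<in>carrier R. s \<otimes> r \<otimes> y \<in> K}"
  have "ideal T' R"
  proof (rule ideal_if_closed)
    fix x r assume x: "x \<in> T'" and r: "r \<in> carrier R"
    have "s \<otimes> r' \<otimes> (r \<otimes> x) \<in> K" if "s \<in> S" "r' \<in> carrier R" for s r'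
    proof -
      have "s \<otimes> (r' \<otimes> r) \<otimes> x \<in> K" using x r that by (simp add: T'_def)
      moreover have "s \<in> carrier R" "x \<in> carrier R" using that S x by (auto simp: T'_def)
      ultimately show ?thesis using r that by (simp add: m_assoc)
    qed
    then show "r \<otimes> x \<in> T'" using x r by (simp add: T'_def)
    have "s \<otimes> r' \<otimes> (x \<otimes> r) \<in> K" if "s \<in> S" "r' \<in> carrier R" for s r'
    proof -
      have "s \<otimes> r' \<otimes> x \<otimes> r \<in> K" using x r that by (simp add: T'_def K.I_r_closed)
      moreover have "s \<in> carrier R" "x \<in> carrier R" using that S x by (auto simp: T'_def)
      ultimately show ?thesis using r that by (simp add: m_assoc)
    qed
    then show "x \<otimes> r \<in> T'" using x r by (simp add: T'_def)
  next
    fix x y assume "x \<in> T'" "y \<in> T'"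
    then show "x \<oplus> y \<in> T'" using S by (auto simp: T'_def r_distr subset_iff)
  qed (use S in \<open>auto simp: T'_def subset_iff\<close>)
  moreover have "T \<subseteq> T'" using T STK by (auto simp: T'_def)
  ultimately have T': "Idl T \<subseteq> T'" by (rule genideal_minimal)
  define S' where "S' = {x \<in> carrier R. \<forall>y\<in>Idl T. x \<otimes> y \<in> K}"
  interpret T: ideal "Idl T" R by (rule genideal_ideal[OF T])
  have "ideal S' R"
  proof (rule ideal_if_closed)
    fix x r assume x: "x \<in> S'" and r: "r \<in> carrier R"
    show "r \<otimes> x \<in> S'" "x \<otimes> r \<in> S'"
      using x r T.Icarr by (auto simp: S'_def m_assoc K.I_l_closed T.I_l_closed)
  next
    fix x y assume "x \<in> S'" "y \<in> S'"
    then show "x \<oplus> y \<in> S'" using T.Icarr by (auto simp: S'_def l_distr)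
  qed (use T.Icarr in \<open>auto simp: S'_def\<close>)
  moreover have "S \<subseteq> S'"
  proof
    fix s assume s: "s \<in> S"
    have "s \<otimes> \<one> \<otimes> y \<in> K" if "y \<in> Idl T" for y using T' s that by (auto simp: T'_def)
    then show "s \<in> S'" using S s by (auto simp: S'_def)
  qed
  ultimately have S': "Idl S \<subseteq> S'" by (rule genideal_minimal)
  show ?thesis
  proof
    fix z assume "z \<in> (Idl S) \<cdot> (Idl T)"
    then show "z \<in> K"
      by (induct z rule: ideal_prod.induct) (use S' in \<open>auto simp: S'_def\<close>)
  qed
qed

lemma ideals_set_one [simp]: "\<one>\<^bsub>ideals_set R\<^esub> = carrier R"
  by (simp add: ideals_set_def)

lemma ideals_set_mult [simp]: "I \<otimes>\<^bsub>ideals_set R\<^esub> J = I \<cdot> J"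
  by (simp add: ideals_set_def)

lemma ideal_pow_ideal:
  assumes "ideal I R"
  shows "ideal (I [^]\<^bsub>ideals_set R\<^esub> (n::nat)) R"
  by (induction n) (simp_all add: oneideal ideal_prod_is_ideal assms)

lemma ideal_pow_add:
  assumes I: "ideal I R"
  shows "I [^]\<^bsub>ideals_set R\<^esub> (m + n) = (I [^]\<^bsub>ideals_set R\<^esub> (m::nat)) \<cdot> (I [^]\<^bsub>ideals_set R\<^esub> (n::nat))"
  by (induction n)
    (simp_all add: ideal_prod_one ideal_prod_assoc ideal_pow_ideal I)

lemma ideal_pow_antimono:
  assumes I: "ideal I R" and "m \<le> n"
  shows "I [^]\<^bsub>ideals_set R\<^esub> (n::nat) \<subseteq> I [^]\<^bsub>ideals_set R\<^esub> (m::nat)"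
proof -
  obtain k where "n = m + k" using \<open>m \<le> n\<close> le_Suc_ex by blast
  then show ?thesis
    using ideal_prod_inter[OF ideal_pow_ideal ideal_pow_ideal] ideal_pow_add I by fastforce
qed

lemma nat_pow_in_ideal_pow:
  assumes "a \<in> I"
  shows "a [^] (n::nat) \<in> I [^]\<^bsub>ideals_set R\<^esub> n"
  by (induction n) (auto intro: ideal_prod.prod assms)

end


section \<open>Homogeneous ideals\<close>

lemma (in grading) decomp_carrier:
  assumes "homogeneous_decomp G A x f"
  shows "x \<in> carrier G"
proof -
  have "f n \<in> carrier G" for n
    using assms component_carrier by (auto simp: homogeneous_decomp_def)
  then have "(\<Oplus>n\<in>{n. f n \<noteq> \<zero>}. f n) \<in> carrier G" by (intro finsum_closed) blast
  then show ?thesis using assms by (simp add: homogeneous_decomp_def)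
qed

lemma (in grading) decomp_unique:
  assumes "homogeneous_decomp G A x f" "homogeneous_decomp G A x g"
  shows "f = g"
proof -
  show ?thesis using unique_decomp[OF decomp_carrier[OF assms(1)]] assms by blast
qed

lemma (in grading) decomp_component:
  assumes "x \<in> A i"
  shows "homogeneous_decomp G A x (\<lambda>n. if n = i then x else \<zero>)"
  by (rule decompI[of _ "{i}"]) (use assms component_zero component_carrier in auto)

context graded_ring
begin

lemma decomp_mult_components:
  assumes f: "homogeneous_decomp R A x f" and g: "homogeneous_decomp R A y g"
  shows "homogeneous_decomp R A (x \<otimes> y) (\<lambda>n. \<Oplus>j\<in>{j. g j \<noteq> \<zero>}. f (n - j) \<otimes> g j)"
proof -
  show ?thesis
    using decomp_mult[OF f decomp_carrier[OF f], of g "{j. g j \<noteq> \<zero>}"] g by (simp add: homogeneous_decomp_def)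
qed

lemma homogeneous_ideal_component:
  assumes "homogeneous_ideal R A I" "x \<in> I" "homogeneous_decomp R A x f"
  shows "f n \<in> I"
  using assms by (auto simp: homogeneous_ideal_def)

lemma homogeneous_ideal_genideal:
  assumes S: "S \<subseteq> carrier R"
    and comp: "\<And>x f n. \<lbrakk>x \<in> S; homogeneous_decomp R A x f\<rbrakk> \<Longrightarrow> f n \<in> Idl S"
  shows "homogeneous_ideal R A (Idl S)"
proof -
  interpret I: ideal "Idl S" R by (rule genideal_ideal[OF S])
  define H where "H = {x \<in> Idl S. \<forall>f. homogeneous_decomp R A x f \<longrightarrow> (\<forall>n. f n \<in> Idl S)}"
  have HI: "x \<in> H" if "x \<in> Idl S" "homogeneous_decomp R A x f" "\<And>n. f n \<in> Idl S" for x f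
    using that decomp_unique unfolding H_def by blast
  have fin: "finite {j. f j \<noteq> \<zero>}" and fc: "f n \<in> carrier R" if "homogeneous_decomp R A x f" for x f n
    using that component_carrier by (auto simp: homogeneous_decomp_def)
  have "ideal H R"
  proof (rule ideal_if_closed)
    show "H \<subseteq> carrier R" using I.Icarr by (auto simp: H_def)
    show "\<zero> \<in> H" by (rule HI[OF _ decomp_zero]) auto
  next
    fix x y assume x: "x \<in> H" and y: "y \<in> H"
    then have xy: "x \<in> Idl S" "y \<in> Idl S" by (auto simp: H_def)
    obtain f g where f: "homogeneous_decomp R A x f" and g: "homogeneous_decomp R A y g"
      using xy I.Icarr unique_decomp by meson
    show "x \<oplus> y \<in> H"
      by (rule HI[OF _ decomp_add[OF f g]]) (use x y xy f g in \<open>auto simp: H_def\<close>)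
  next
    fix x r assume x: "x \<in> H" and r: "r \<in> carrier R"
    then have x': "x \<in> Idl S" by (auto simp: H_def)
    obtain f g where f: "homogeneous_decomp R A x f" and g: "homogeneous_decomp R A r g"
      using x' r I.Icarr unique_decomp by meson
    have fI: "f n \<in> Idl S" for n using x f by (auto simp: H_def)
    show "r \<otimes> x \<in> H"
      by (rule HI[OF _ decomp_mult_components[OF g f]])
        (use x' r fI fin fc f g in
          \<open>auto intro!: I.I_l_closed finsum_in_ideal[OF I.is_ideal]\<close>)
    show "x \<otimes> r \<in> H"
      by (rule HI[OF _ decomp_mult_components[OF f g]])
        (use x' r fI fin fc f g in
          \<open>auto intro!: I.I_r_closed finsum_in_ideal[OF I.is_ideal]\<close>)
  qed
  moreover have "S \<subseteq> H"
    using genideal_self[OF S] comp by (auto simp: H_def)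
  ultimately have "Idl S \<subseteq> H" by (rule genideal_minimal)
  then show ?thesis
    using I.is_ideal by (auto simp: homogeneous_ideal_def H_def)
qed

lemma homogeneous_ideal_genideal_insert:
  assumes q: "homogeneous_ideal R A q" and a: "a \<in> A i"
  shows "homogeneous_ideal R A (Idl (insert a q))"
proof (rule homogeneous_ideal_genideal)
  interpret q: ideal q R using q by (simp add: homogeneous_ideal_def)
  show S: "insert a q \<subseteq> carrier R" using component_carrier[OF a] q.Icarr by blast
  note self = genideal_self[OF S]
  fix x f n assume x: "x \<in> insert a q" and f: "homogeneous_decomp R A x f"
  show "f n \<in> Idl (insert a q)"
  proof (cases "x = a")
    case True
    then have "f = (\<lambda>n. if n = i then a else \<zero>)"
      using decomp_unique f decomp_component[OF a] by blast
    then show ?thesis using self by auto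
  next
    case False
    then show ?thesis using homogeneous_ideal_component[OF q _ f] x self by blast
  qed
qed

lemma homogeneous_generators:
  assumes J: "homogeneous_ideal R A J" and fg: "finitely_generated_ideal R J"
  obtains T where "finite T" "T \<subseteq> (\<Union>n. A n)" "J = Idl T"
proof -
  interpret J: ideal J R using J by (simp add: homogeneous_ideal_def)
  obtain S where S: "finite S" "S \<subseteq> carrier R" "J = Idl S"
    using fg by (auto simp: finitely_generated_ideal_def)
  have "\<forall>x\<in>S. \<exists>f. homogeneous_decomp R A x f" using S(2) unique_decomp by blast
  then obtain F where F: "\<And>x. x \<in> S \<Longrightarrow> homogeneous_decomp R A x (F x)" by metis
  define T where "T = (\<Union>x\<in>S. F x ` {n. F x n \<noteq> \<zero>})"
  have fin: "finite T" unfolding T_def using S(1) F by (auto simp: homogeneous_decomp_def)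
  have sub: "T \<subseteq> (\<Union>n. A n)" unfolding T_def using F by (auto simp: homogeneous_decomp_def)
  then have Tc: "T \<subseteq> carrier R" using component_carrier by blast
  have "T \<subseteq> J"
    unfolding T_def using F homogeneous_ideal_component[OF J] genideal_self[OF S(2)] S(3) by blast
  then have 1: "Idl T \<subseteq> J" by (rule genideal_minimal[OF J.is_ideal])
  have "S \<subseteq> Idl T"
  proof
    fix x assume x: "x \<in> S"
    have "(\<Oplus>n\<in>{n. F x n \<noteq> \<zero>}. F x n) \<in> Idl T"
      by (rule finsum_in_ideal[OF genideal_ideal[OF Tc]])
        (use F[OF x] x genideal_self[OF Tc] in \<open>auto simp: T_def homogeneous_decomp_def\<close>)
    then show "x \<in> Idl T" using F[OF x] by (simp add: homogeneous_decomp_def)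
  qed
  then have "J \<subseteq> Idl T" unfolding S(3) by (rule genideal_minimal[OF genideal_ideal[OF Tc]])
  then show ?thesis using that fin sub 1 by blast
qed

lemma homogeneous_ideal_Union_chain:
  assumes C: "C \<noteq> {}" "subset.chain {I. homogeneous_ideal R A I} C"
  shows "homogeneous_ideal R A (\<Union>C)"
proof -
  have "subset.chain {I. ideal I R} C"
    using C(2) by (auto simp: subset_chain_def homogeneous_ideal_def)
  then have "ideal (\<Union>C) R" using chain_Union_is_ideal[of C] C(1) by simp
  then show ?thesis using C(2) by (fastforce simp: subset_chain_def homogeneous_ideal_def)
qed

lemma Spec_h_Inter_chain:
  assumes C: "C \<noteq> {}" "C \<subseteq> Spec_h R A" "\<And>p q. \<lbrakk>p \<in> C; q \<in> C\<rbrakk> \<Longrightarrow> p \<subseteq> q \<or> q \<subseteq> p"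
  shows "\<Inter>C \<in> Spec_h R A"
proof -
  have h: "homogeneous_ideal R A p" if "p \<in> C" for p using that C by (auto simp: Spec_h_def)
  have "ideal (\<Inter>C) R"
    by (rule i_Intersect) (use h C(1) in \<open>auto simp: homogeneous_ideal_def\<close>)
  then have "homogeneous_ideal R A (\<Inter>C)"
    using h by (fastforce simp: homogeneous_ideal_def)
  moreover have "carrier R \<noteq> \<Inter>C"
  proof -
    obtain p where p: "p \<in> C" using C(1) by blast
    then have "p \<subseteq> carrier R" "carrier R \<noteq> p"
      using C h[OF p] by (auto simp: Spec_h_def homogeneous_ideal_def ideal.Icarr)
    then show ?thesis using p by blast
  qed
  moreover have "x \<in> \<Inter>C \<or> y \<in> \<Inter>C"
    if "x \<in> carrier R" "y \<in> carrier R" "x \<otimes> y \<in> \<Inter>C" for x y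
  proof (rule ccontr)
    assume "\<not> ?thesis"
    then obtain p q where "p \<in> C" "q \<in> C" "x \<notin> p" "y \<notin> q" by blast
    then obtain r where "r \<in> C" "x \<notin> r" "y \<notin> r" using C(3) by blast
    then show False using C(2) that by (auto simp: Spec_h_def)
  qed
  ultimately show ?thesis by (simp add: Spec_h_def)
qed

lemma minimal_prime_below:
  assumes q: "q \<in> Spec_h R A" "I \<subseteq> q"
  obtains p where "p \<in> Spec_h R A" "I \<subseteq> p" "p \<subseteq> q"
    "\<And>p'. \<lbrakk>p' \<in> Spec_h R A; I \<subseteq> p'; p' \<subseteq> p\<rbrakk> \<Longrightarrow> p' = p"
proof -
  define P where "P = {p \<in> Spec_h R A. I \<subseteq> p \<and> p \<subseteq> q}"
  have "\<exists>M\<in>uminus ` P. \<forall>N\<in>uminus ` P. M \<subseteq> N \<longrightarrow> N = M"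
  proof (rule subset_Zorn_nonempty)
    show "uminus ` P \<noteq> {}" using q by (auto simp: P_def)
  next
    fix C assume C: "C \<noteq> {}" "subset.chain (uminus ` P) C"
    define D where "D = uminus ` C"
    have D: "D \<subseteq> P" using C(2) by (auto simp: D_def subset_chain_def)
    have "p \<subseteq> p' \<or> p' \<subseteq> p" if "p \<in> D" "p' \<in> D" for p p'
    proof -
      obtain N N' where "N \<in> C" "p = - N" "N' \<in> C" "p' = - N'" using \<open>p \<in> D\<close> \<open>p' \<in> D\<close> by (auto simp: D_def)
      moreover from this have "N \<subseteq> N' \<or> N' \<subseteq> N" using C(2) unfolding subset_chain_def by blast
      ultimately show ?thesis by blast
    qed
    moreover have D': "D \<noteq> {}" "D \<subseteq> Spec_h R A" using C(1) D by (auto simp: D_def P_def)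
    ultimately have "\<Inter>D \<in> Spec_h R A" by (intro Spec_h_Inter_chain)
    then have "\<Inter>D \<in> P" using D'(1) D unfolding P_def by blast
    moreover have "\<Union>C = - \<Inter>D" by (auto simp: D_def)
    ultimately show "\<Union>C \<in> uminus ` P" by blast
  qed
  then obtain p where p: "p \<in> P" and max: "\<forall>N\<in>uminus ` P. - p \<subseteq> N \<longrightarrow> N = - p" by (elim bexE imageE) simp
  have "p' = p" if "p' \<in> Spec_h R A" "I \<subseteq> p'" "p' \<subseteq> p" for p'
  proof -
    have "p' \<in> P" using that p unfolding P_def by blast
    then have "- p' = - p" using max that(3) by simp
    then show ?thesis by simp
  qed
  then show ?thesis using that p by (auto simp: P_def)
qed

end


section \<open>Primes not containing a finitely generated ideal\<close>

context graded_commutative_ring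
begin

lemma homogeneous_mult_swap:
  assumes K: "ideal K R" and s: "s \<in> A i" and t: "t \<in> carrier R" "s \<otimes> t \<in> K" and r: "r \<in> carrier R"
  shows "s \<otimes> r \<otimes> t \<in> K"
proof -
  interpret K: ideal K R by fact
  obtain f where f: "homogeneous_decomp R A r f" using unique_decomp[OF r] by blast
  define S where "S = {n. f n \<noteq> \<zero>}"
  have fA: "f n \<in> A n" for n using f by (simp add: homogeneous_decomp_def)
  have fin: "finite S" and r_eq: "r = (\<Oplus>n\<in>S. f n)"
    using f by (auto simp: S_def homogeneous_decomp_def)
  have sc: "s \<in> carrier R" and fc: "f n \<in> carrier R" for n
    using s fA component_carrier by auto
  have "s \<otimes> f n \<otimes> t \<in> K" for n
  proof -
    have "f n \<otimes> s \<otimes> t \<in> K" using t sc fc by (simp add: m_assoc K.I_l_closed)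
    moreover from this have "\<ominus> (f n \<otimes> s) \<otimes> t \<in> K"
      using t sc fc by (simp add: l_minus K.a_inv_closed)
    ultimately show ?thesis using graded_commute[OF s fA] by simp
  qed
  then have "(\<Oplus>n\<in>S. s \<otimes> f n \<otimes> t) \<in> K" by (intro finsum_in_ideal K.is_ideal fin)
  moreover have "(\<Oplus>n\<in>S. s \<otimes> f n \<otimes> t) = s \<otimes> r \<otimes> t"
    unfolding r_eq using fin sc fc t by (simp add: finsum_ldistr finsum_rdistr)
  ultimately show ?thesis by simp
qed

lemma ideal_pow_generators:
  assumes S: "finite S" "S \<subseteq> (\<Union>n. A n)"
  shows "\<exists>T. finite T \<and> T \<subseteq> (\<Union>n. A n) \<and> (Idl S) [^]\<^bsub>ideals_set R\<^esub> (k::nat) = Idl T"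
proof (induction k)
  case 0
  have "{\<one>} \<subseteq> (\<Union>n. A n)" using one_degree by blast
  then show ?case using genideal_one by (intro exI[of _ "{\<one>}"]) simp
next
  case (Suc k)
  then obtain T where T: "finite T" "T \<subseteq> (\<Union>n. A n)"
    and eq: "(Idl S) [^]\<^bsub>ideals_set R\<^esub> k = Idl T" by blast
  have Sc: "S \<subseteq> carrier R" and Tc: "T \<subseteq> carrier R" using S T component_carrier by blast+
  define U where "U = (\<lambda>(t, s). t \<otimes> s) ` (T \<times> S)"
  have U: "finite U" "U \<subseteq> (\<Union>n. A n)"
    using S T mult_degree by (fastforce simp: U_def)+
  then have Uc: "U \<subseteq> carrier R" using component_carrier by blast
  have "(Idl T) \<cdot> (Idl S) \<subseteq> Idl U"
  proof (rule ideal_prod_genideal_subset[OF genideal_ideal[OF Uc] Tc Sc])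
    fix t r s assume t: "t \<in> T" and r: "r \<in> carrier R" and s: "s \<in> S"
    obtain i where "t \<in> A i" using t T by blast
    moreover have "t \<otimes> s \<in> Idl U" using genideal_self[OF Uc] t s by (auto simp: U_def)
    ultimately show "t \<otimes> r \<otimes> s \<in> Idl U"
      using homogeneous_mult_swap genideal_ideal[OF Uc] s Sc r by blast
  qed
  moreover have "Idl U \<subseteq> (Idl T) \<cdot> (Idl S)"
    by (intro genideal_minimal ideal_prod_is_ideal genideal_ideal Sc Tc)
      (use genideal_self[OF Sc] genideal_self[OF Tc] in \<open>auto simp: U_def intro!: ideal_prod.prod\<close>)
  ultimately show ?case using U by (auto simp: eq)
qed

lemma prime_if_maximal_avoiding_powers:
  assumes J: "ideal J R" and q: "homogeneous_ideal R A q"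
    and avoid: "\<And>k::nat. \<not> J [^]\<^bsub>ideals_set R\<^esub> k \<subseteq> q"
    and max: "\<And>q'. \<lbrakk>homogeneous_ideal R A q'; q \<subset> q'\<rbrakk> \<Longrightarrow> \<exists>k::nat. J [^]\<^bsub>ideals_set R\<^esub> k \<subseteq> q'"
  shows "q \<in> Spec_h R A"
proof -
  interpret q: ideal q R using q by (simp add: homogeneous_ideal_def)
  have "carrier R \<noteq> q" using avoid[of 0] by auto
  moreover have "a \<in> q \<or> b \<in> q" if a: "a \<in> A i" and b: "b \<in> A j" and ab: "a \<otimes> b \<in> q" for a b i j
  proof (rule ccontr)
    assume nin: "\<not> ?thesis"
    have ex: "\<exists>k::nat. J [^]\<^bsub>ideals_set R\<^esub> k \<subseteq> Idl (insert c q)" if c: "c \<in> A n" "c \<notin> q" for c n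
    proof (rule max[OF homogeneous_ideal_genideal_insert[OF q c(1)]])
      have "insert c q \<subseteq> carrier R" using component_carrier[OF c(1)] q.Icarr by blast
      then show "q \<subset> Idl (insert c q)" using genideal_self c(2) by blast
    qed
    obtain k where k: "J [^]\<^bsub>ideals_set R\<^esub> (k::nat) \<subseteq> Idl (insert a q)" using ex a nin by blast
    obtain l where l: "J [^]\<^bsub>ideals_set R\<^esub> (l::nat) \<subseteq> Idl (insert b q)" using ex b nin by blast
    have c: "a \<in> carrier R" "b \<in> carrier R" using a b component_carrier by auto
    have "x \<otimes> r \<otimes> y \<in> q" if "x \<in> insert a q" "r \<in> carrier R" "y \<in> insert b q" for x r y
      using that c q.Icarr homogeneous_mult_swap[OF q.is_ideal a c(2) ab, of r]
      by (auto simp: q.I_l_closed q.I_r_closed)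
    then have "(Idl (insert a q)) \<cdot> (Idl (insert b q)) \<subseteq> q"
      using c q.Icarr by (intro ideal_prod_genideal_subset[OF q.is_ideal]) auto
    moreover have "J [^]\<^bsub>ideals_set R\<^esub> (k + l) \<subseteq> (Idl (insert a q)) \<cdot> (Idl (insert b q))"
    proof
      fix z assume "z \<in> J [^]\<^bsub>ideals_set R\<^esub> (k + l)"
      then have "z \<in> (J [^]\<^bsub>ideals_set R\<^esub> k) \<cdot> (J [^]\<^bsub>ideals_set R\<^esub> l)"
        by (simp add: ideal_pow_add[OF J])
      then show "z \<in> (Idl (insert a q)) \<cdot> (Idl (insert b q))"
        by (induct z rule: ideal_prod.induct) (use k l in \<open>auto intro: ideal_prod.intros\<close>)
    qed
    ultimately show False using avoid by blast
  qed
  ultimately show ?thesis using q unfolding Spec_h_iff by blast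
qed

lemma exists_prime_avoiding_powers:
  assumes J: "homogeneous_ideal R A J" "finitely_generated_ideal R J"
    and K: "homogeneous_ideal R A K" and avoid: "\<And>k::nat. \<not> J [^]\<^bsub>ideals_set R\<^esub> k \<subseteq> K"
  obtains q where "q \<in> Spec_h R A" "K \<subseteq> q" "\<not> J \<subseteq> q"
proof -
  have Ji: "ideal J R" using J by (simp add: homogeneous_ideal_def)
  obtain S where S: "finite S" "S \<subseteq> (\<Union>n. A n)" "J = Idl S"
    using homogeneous_generators[OF J] by blast
  define Q where "Q = {q. homogeneous_ideal R A q \<and> K \<subseteq> q \<and> (\<forall>k::nat. \<not> J [^]\<^bsub>ideals_set R\<^esub> k \<subseteq> q)}"
  have "\<exists>M\<in>Q. \<forall>N\<in>Q. M \<subseteq> N \<longrightarrow> N = M"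
  proof (rule subset_Zorn_nonempty)
    show "Q \<noteq> {}" using K avoid by (auto simp: Q_def)
  next
    fix C assume C: "C \<noteq> {}" "subset.chain Q C"
    then have CQ: "C \<subseteq> Q" by (simp add: subset_chain_def)
    have "homogeneous_ideal R A (\<Union>C)"
      using C by (intro homogeneous_ideal_Union_chain) (auto simp: subset_chain_def Q_def)
    moreover have "K \<subseteq> \<Union>C" using C(1) CQ by (auto simp: Q_def)
    moreover have "\<not> J [^]\<^bsub>ideals_set R\<^esub> k \<subseteq> \<Union>C" for k :: nat
    proof
      assume sub: "J [^]\<^bsub>ideals_set R\<^esub> k \<subseteq> \<Union>C"
      obtain T where T: "finite T" "T \<subseteq> (\<Union>n. A n)" "J [^]\<^bsub>ideals_set R\<^esub> k = Idl T"
        using ideal_pow_generators[OF S(1,2)] S(3) by blast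
      have "T \<subseteq> carrier R" using T(2) component_carrier by blast
      then have "T \<subseteq> \<Union>C" using genideal_self sub T(3) by blast
      then obtain q where q: "q \<in> C" "T \<subseteq> q"
        using finite_subset_Union_chain[OF T(1) _ C] by blast
      then have "J [^]\<^bsub>ideals_set R\<^esub> k \<subseteq> q"
        using CQ unfolding T(3) by (intro genideal_minimal) (auto simp: Q_def homogeneous_ideal_def)
      then show False using CQ q(1) by (auto simp: Q_def)
    qed
    ultimately show "\<Union>C \<in> Q" by (simp add: Q_def)
  qed
  then obtain q where q: "q \<in> Q" and max: "\<And>q'. \<lbrakk>q' \<in> Q; q \<subseteq> q'\<rbrakk> \<Longrightarrow> q' = q" by blast
  have "q \<in> Spec_h R A"
  proof (rule prime_if_maximal_avoiding_powers[OF Ji])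
    fix q' assume "homogeneous_ideal R A q'" "q \<subset> q'"
    then show "\<exists>k::nat. J [^]\<^bsub>ideals_set R\<^esub> k \<subseteq> q'" using max[of q'] q by (auto simp: Q_def)
  qed (use q in \<open>auto simp: Q_def\<close>)
  moreover have "\<not> J \<subseteq> q"
  proof
    assume "J \<subseteq> q"
    then have "J [^]\<^bsub>ideals_set R\<^esub> Suc 0 \<subseteq> q" using ideal_prod_inter[OF oneideal Ji] by auto
    then show False using q unfolding Q_def by blast
  qed
  ultimately show ?thesis using that q by (auto simp: Q_def)
qed

end


section \<open>Annihilators and torsion\<close>

context left_module
begin

lemma smult_l_zero: "x \<in> carrier M \<Longrightarrow> \<zero>\<^bsub>R\<^esub> \<odot>\<^bsub>M\<^esub> x = \<zero>\<^bsub>M\<^esub>"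
  by (metis M.add.l_cancel_one R.l_zero R.zero_closed smult_closed smult_l_distr)

lemma smult_r_zero: "r \<in> carrier R \<Longrightarrow> r \<odot>\<^bsub>M\<^esub> \<zero>\<^bsub>M\<^esub> = \<zero>\<^bsub>M\<^esub>"
  by (metis M.add.l_cancel_one M.l_zero M.zero_closed smult_closed smult_r_distr)

lemma smult_finsum_left:
  assumes "finite S" "\<And>n. f n \<in> carrier R" "x \<in> carrier M"
  shows "(\<Oplus>\<^bsub>R\<^esub>n\<in>S. f n) \<odot>\<^bsub>M\<^esub> x = (\<Oplus>\<^bsub>M\<^esub>n\<in>S. f n \<odot>\<^bsub>M\<^esub> x)"
  using assms(1)
  by (induction S rule: finite_induct)
    (simp_all add: smult_l_zero smult_l_distr smult_closed assms Pi_def)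

lemma smult_finsum_zero:
  assumes "finite S" "\<And>n. f n \<in> carrier M" "\<And>n. n \<in> S \<Longrightarrow> r \<odot>\<^bsub>M\<^esub> f n = \<zero>\<^bsub>M\<^esub>" "r \<in> carrier R"
  shows "r \<odot>\<^bsub>M\<^esub> (\<Oplus>\<^bsub>M\<^esub>n\<in>S. f n) = \<zero>\<^bsub>M\<^esub>"
  using assms(1,3)
  by (induction S rule: finite_induct)
    (simp_all add: smult_r_zero smult_r_distr smult_closed assms(2,4) Pi_def)

end

lemma (in graded_module) decomp_smult:
  assumes f: "homogeneous_decomp R A r f" and x: "x \<in> B j"
  shows "homogeneous_decomp M B (r \<odot>\<^bsub>M\<^esub> x) (\<lambda>n. f (n - j) \<odot>\<^bsub>M\<^esub> x)"
proof -
  define S where "S = {n. f n \<noteq> \<zero>\<^bsub>R\<^esub>}"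
  have fA: "f n \<in> A n" for n using f by (auto simp: homogeneous_decomp_def)
  have fin: "finite S" using f by (auto simp: S_def homogeneous_decomp_def)
  have xc: "x \<in> carrier M" using x by (rule M.component_carrier)
  have fc: "f n \<in> carrier R" for n using fA by (rule R.component_carrier)
  show ?thesis
  proof (rule M.decompI[where S = "(\<lambda>n. n + j) ` S"])
    show "f (n - j) \<odot>\<^bsub>M\<^esub> x \<in> B n" for n using smult_degree[OF fA x, of "n - j"] by simp
    show "f (n - j) \<odot>\<^bsub>M\<^esub> x = \<zero>\<^bsub>M\<^esub>" if "n \<notin> (\<lambda>n. n + j) ` S" for n
    proof -
      have "n - j \<notin> S" using that by (metis diff_add_cancel image_eqI)
      then show ?thesis using xc by (simp add: S_def smult_l_zero)
    qed
    have "(\<Oplus>\<^bsub>M\<^esub>n\<in>(\<lambda>n. n + j) ` S. f (n - j) \<odot>\<^bsub>M\<^esub> x) = (\<Oplus>\<^bsub>M\<^esub>n\<in>S. f n \<odot>\<^bsub>M\<^esub> x)"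
      by (subst M.finsum_reindex) (auto simp: fc xc smult_closed inj_on_def)
    also have "\<dots> = (\<Oplus>\<^bsub>R\<^esub>n\<in>S. f n) \<odot>\<^bsub>M\<^esub> x"
      by (rule smult_finsum_left[symmetric]) (auto simp: fin xc fc)
    finally show "r \<odot>\<^bsub>M\<^esub> x = (\<Oplus>\<^bsub>M\<^esub>n\<in>(\<lambda>n. n + j) ` S. f (n - j) \<odot>\<^bsub>M\<^esub> x)"
      using R.decompD[OF f fin] by (simp add: S_def)
  qed (use fin in simp)
qed

lemma (in graded_module) Ann_component:
  assumes x: "x \<in> B j" and r: "r \<in> Ann R M x" and f: "homogeneous_decomp R A r f"
  shows "f n \<in> Ann R M x"
proof -
  have "(\<lambda>n. f (n - j) \<odot>\<^bsub>M\<^esub> x) = (\<lambda>n. \<zero>\<^bsub>M\<^esub>)"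
    by (rule M.decomp_unique[OF decomp_smult[OF f x]])
      (use r M.decomp_zero in \<open>simp add: Ann_def\<close>)
  from fun_cong[OF this, of "n + j"] have "f n \<odot>\<^bsub>M\<^esub> x = \<zero>\<^bsub>M\<^esub>" by simp
  moreover have "f n \<in> carrier R"
    using f R.component_carrier by (auto simp: homogeneous_decomp_def)
  ultimately show ?thesis by (simp add: Ann_def)
qed

locale graded_commutative_module =
  graded_module R A M B + R?: graded_commutative_ring R A
  for R :: "('a, 'm) ring_scheme" (structure) and A
    and M :: "('a, 'b, 'n) module_scheme" (structure) and B
begin

lemma homogeneous_ideal_Ann:
  assumes x: "x \<in> B j"
  shows "homogeneous_ideal R A (Ann R M x)"
proof -
  have xc: "x \<in> carrier M" using x by (rule M.component_carrier)
  have "ideal (Ann R M x) R"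
  proof (rule R.ideal_if_closed)
    show "Ann R M x \<subseteq> carrier R" "\<zero>\<^bsub>R\<^esub> \<in> Ann R M x"
      using xc by (auto simp: Ann_def smult_l_zero)
    show "r \<oplus>\<^bsub>R\<^esub> s \<in> Ann R M x" if "r \<in> Ann R M x" "s \<in> Ann R M x" for r s
      using that xc by (auto simp: Ann_def smult_l_distr)
    fix r t assume r: "r \<in> Ann R M x" and t: "t \<in> carrier R"
    have rc: "r \<in> carrier R" using r by (simp add: Ann_def)
    show "t \<otimes>\<^bsub>R\<^esub> r \<in> Ann R M x" using r t xc by (auto simp: Ann_def smult_assoc smult_r_zero)
    obtain f where f: "homogeneous_decomp R A r f" using R.unique_decomp[OF rc] by blast
    obtain g where g: "homogeneous_decomp R A t g" using R.unique_decomp[OF t] by blast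
    define S T where "S = {n. f n \<noteq> \<zero>\<^bsub>R\<^esub>}" and "T = {n. g n \<noteq> \<zero>\<^bsub>R\<^esub>}"
    have fA: "f n \<in> A n" and gA: "g n \<in> A n" for n
      using f g by (auto simp: homogeneous_decomp_def)
    have c: "f n \<in> carrier R" "g n \<in> carrier R" for n
      using fA gA R.component_carrier by auto
    have ST: "finite S" "finite T" "r = (\<Oplus>\<^bsub>R\<^esub>n\<in>S. f n)" "t = (\<Oplus>\<^bsub>R\<^esub>n\<in>T. g n)"
      using f g by (auto simp: S_def T_def homogeneous_decomp_def)
    have fg: "(f n \<otimes>\<^bsub>R\<^esub> g m) \<odot>\<^bsub>M\<^esub> x = \<zero>\<^bsub>M\<^esub>" for n m
    proof -
      have "f n \<odot>\<^bsub>M\<^esub> x = \<zero>\<^bsub>M\<^esub>" using Ann_component[OF x r f] by (simp add: Ann_def)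
      then have *: "(g m \<otimes>\<^bsub>R\<^esub> f n) \<odot>\<^bsub>M\<^esub> x = \<zero>\<^bsub>M\<^esub>" using c xc by (simp add: smult_assoc smult_r_zero)
      moreover have "\<ominus>\<^bsub>R\<^esub> (g m \<otimes>\<^bsub>R\<^esub> f n) \<odot>\<^bsub>M\<^esub> x
          = (\<ominus>\<^bsub>R\<^esub> \<one>\<^bsub>R\<^esub>) \<odot>\<^bsub>M\<^esub> ((g m \<otimes>\<^bsub>R\<^esub> f n) \<odot>\<^bsub>M\<^esub> x)"
        using c xc by (simp add: R.l_minus flip: smult_assoc)
      ultimately show ?thesis using R.graded_commute[OF fA gA, of n m] by (simp add: smult_r_zero)
    qed
    have "(f n \<otimes>\<^bsub>R\<^esub> t) \<odot>\<^bsub>M\<^esub> x = \<zero>\<^bsub>M\<^esub>" for n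
      unfolding ST(4) using ST(2) c xc fg by (simp add: R.finsum_rdistr smult_finsum_left)
    then have "(r \<otimes>\<^bsub>R\<^esub> t) \<odot>\<^bsub>M\<^esub> x = \<zero>\<^bsub>M\<^esub>"
      using ST(1,3) c xc t by (simp add: R.finsum_ldistr smult_finsum_left)
    then show "r \<otimes>\<^bsub>R\<^esub> t \<in> Ann R M x" using rc t by (simp add: Ann_def)
  qed
  then show ?thesis using Ann_component[OF x] by (auto simp: homogeneous_ideal_def)
qed

lemma torsion_ideal_mem_small_supp:
  assumes p: "p \<in> small_supp R A M B" and J: "torsion_module R M J" and a: "a \<in> J" "a \<in> carrier R"
  shows "a \<in> p"
proof -
  obtain x n where x: "x \<in> B n" "Ann R M x \<subseteq> p" and pS: "p \<in> Spec_h R A"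
    using p by (auto simp: small_supp_def)
  obtain k :: nat where "\<forall>r\<in>J [^]\<^bsub>ideals_set R\<^esub> k. r \<odot>\<^bsub>M\<^esub> x = \<zero>\<^bsub>M\<^esub>"
    using J M.component_carrier[OF x(1)] unfolding torsion_module_def by blast
  then have "a [^]\<^bsub>R\<^esub> k \<in> Ann R M x"
    using R.nat_pow_in_ideal_pow[OF a(1)] a(2) by (simp add: Ann_def)
  then have "a [^]\<^bsub>R\<^esub> k \<in> p" using x(2) by blast
  then show "a \<in> p"
  proof (induction k)
    case 0
    then show ?case using pS ideal.one_imp_carrier
      by (fastforce simp: Spec_h_def homogeneous_ideal_def)
  next
    case (Suc k)
    then show ?case using pS a(2) by (auto simp: Spec_h_def)
  qed
qed

lemma torsion_module_if_small_supp_subset: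
  assumes J: "homogeneous_ideal R A J" "finitely_generated_ideal R J"
    and supp: "\<And>p. p \<in> small_supp R A M B \<Longrightarrow> J \<subseteq> p"
  shows "torsion_module R M J"
proof -
  have Ji: "ideal J R" using J by (simp add: homogeneous_ideal_def)
  have ex: "\<exists>k::nat. J [^]\<^bsub>ideals_set R\<^esub> k \<subseteq> Ann R M x" if x: "x \<in> B n" for x n
  proof (rule ccontr)
    assume "\<not> ?thesis"
    then obtain q where q: "q \<in> Spec_h R A" "Ann R M x \<subseteq> q" "\<not> J \<subseteq> q"
      using R.exists_prime_avoiding_powers[OF J homogeneous_ideal_Ann[OF x]] by blast
    obtain p where p: "p \<in> Spec_h R A" "Ann R M x \<subseteq> p" "p \<subseteq> q"
      "\<And>p'. \<lbrakk>p' \<in> Spec_h R A; Ann R M x \<subseteq> p'; p' \<subseteq> p\<rbrakk> \<Longrightarrow> p' = p"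
      using R.minimal_prime_below[OF q(1,2)] by blast
    have "p \<in> small_supp R A M B" unfolding small_supp_def using x p by blast
    then show False using supp q(3) p(3) by blast
  qed
  show ?thesis
    unfolding torsion_module_def
  proof (intro ballI)
    fix x assume "x \<in> carrier M"
    then obtain f where f: "homogeneous_decomp M B x f" using M.unique_decomp by blast
    define S where "S = {n. f n \<noteq> \<zero>\<^bsub>M\<^esub>}"
    have fB: "f n \<in> B n" for n using f by (simp add: homogeneous_decomp_def)
    have fin: "finite S" and x_eq: "x = (\<Oplus>\<^bsub>M\<^esub>n\<in>S. f n)"
      using f by (auto simp: S_def homogeneous_decomp_def)
    obtain k :: "int \<Rightarrow> nat" where k: "\<And>n. J [^]\<^bsub>ideals_set R\<^esub> k n \<subseteq> Ann R M (f n)"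
      using ex[OF fB] by metis
    define N where "N = (\<Sum>n\<in>S. k n)"
    have "r \<odot>\<^bsub>M\<^esub> x = \<zero>\<^bsub>M\<^esub>" if r: "r \<in> J [^]\<^bsub>ideals_set R\<^esub> N" for r
      unfolding x_eq
    proof (rule smult_finsum_zero[OF fin])
      show "f n \<in> carrier M" for n using fB by (rule M.component_carrier)
      show "r \<in> carrier R" using r ideal.Icarr[OF R.ideal_pow_ideal[OF Ji]] by blast
      fix n assume "n \<in> S"
      then have "k n \<le> N" unfolding N_def using fin by (intro member_le_sum) auto
      then show "r \<odot>\<^bsub>M\<^esub> f n = \<zero>\<^bsub>M\<^esub>"
        using r k R.ideal_pow_antimono[OF Ji] by (fastforce simp: Ann_def)
    qed
    then show "\<exists>N::nat. \<forall>r\<in>J [^]\<^bsub>ideals_set R\<^esub> N. r \<odot>\<^bsub>M\<^esub> x = \<zero>\<^bsub>M\<^esub>" by blast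
  qed
qed

end

theorem lemma3p14:
  fixes R :: "('a, 'm) ring_scheme" and A :: "int \<Rightarrow> 'a set"
    and M :: "('a, 'b, 'n) module_scheme" and B :: "int \<Rightarrow> 'b set"
    and I :: "'a set"
  assumes "graded_commutative_ring R A"
    and "graded_module R A M B"
    and "homogeneous_ideal R A I"
  shows "(torsion_module R M I \<longrightarrow> small_supp R A M B \<subseteq> V_h R A I) \<and>
    (small_supp R A M B \<subseteq> V_h R A I \<longleftrightarrow>
      (\<forall>J. homogeneous_ideal R A J \<and> finitely_generated_ideal R J \<and> J \<subseteq> I
        \<longrightarrow> torsion_module R M J))"
proof -
  interpret graded_commutative_module R A M B
    using assms(1,2) by (rule graded_commutative_module.intro[rotated])
  interpret I: ideal I R using assms(3) by (simp add: homogeneous_ideal_def)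
  have V: "small_supp R A M B \<subseteq> V_h R A I \<longleftrightarrow> (\<forall>p\<in>small_supp R A M B. I \<subseteq> p)"
    by (auto simp: V_h_def small_supp_def)
  have "I \<subseteq> p" if tors: "\<forall>J. homogeneous_ideal R A J \<and> finitely_generated_ideal R J \<and> J \<subseteq> I
      \<longrightarrow> torsion_module R M J" and p: "p \<in> small_supp R A M B" for p
  proof
    fix x assume x: "x \<in> I"
    obtain f where f: "homogeneous_decomp R A x f" using R.unique_decomp[OF I.Icarr[OF x]] by blast
    have fA: "f n \<in> A n" for n using f by (simp add: homogeneous_decomp_def)
    have "f n \<in> p" for n
    proof -
      have c: "f n \<in> carrier R" using fA by (rule R.component_carrier)
      have "homogeneous_ideal R A (Idl\<^bsub>R\<^esub> {f n})"
      proof (rule R.homogeneous_ideal_genideal)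
        show "g m \<in> Idl\<^bsub>R\<^esub> {f n}" if "y \<in> {f n}" "homogeneous_decomp R A y g" for y g m
        proof -
          have "g = (\<lambda>m. if m = n then f n else \<zero>\<^bsub>R\<^esub>)"
            using R.decomp_unique R.decomp_component[OF fA] that by blast
          then show ?thesis
            using R.genideal_self'[OF c] additive_subgroup.zero_closed[OF ideal.axioms(1)[OF
                R.genideal_ideal[of "{f n}"]]] c by auto
        qed
      qed (use c in simp)
      moreover have "finitely_generated_ideal R (Idl\<^bsub>R\<^esub> {f n})"
        unfolding finitely_generated_ideal_def using c by blast
      moreover have "Idl\<^bsub>R\<^esub> {f n} \<subseteq> I"
        by (rule R.genideal_minimal[OF I.is_ideal])
          (use R.homogeneous_ideal_component[OF assms(3) x f] in simp)
      ultimately show ?thesis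
        using torsion_ideal_mem_small_supp[OF p _ R.genideal_self'[OF c] c] tors by blast
    qed
    moreover have "ideal p R" using p by (simp add: small_supp_def Spec_h_def homogeneous_ideal_def)
    ultimately have "(\<Oplus>\<^bsub>R\<^esub>n\<in>{n. f n \<noteq> \<zero>\<^bsub>R\<^esub>}. f n) \<in> p"
      using f by (intro R.finsum_in_ideal) (auto simp: homogeneous_decomp_def)
    then show "x \<in> p" using f by (simp add: homogeneous_decomp_def)
  qed
  moreover have "I \<subseteq> p" if "torsion_module R M I" "p \<in> small_supp R A M B" for p
    using torsion_ideal_mem_small_supp that I.Icarr by blast
  moreover have "torsion_module R M J"
    if "\<forall>p\<in>small_supp R A M B. I \<subseteq> p" "homogeneous_ideal R A J" "finitely_generated_ideal R J" "J \<subseteq> I"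
    for J
    using torsion_module_if_small_supp_subset that by blast
  ultimately show ?thesis unfolding V by blast
qed

end
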